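(* Let $m\ge 0$ be an odd integer such that $\frac{m-1}{2}\equiv -3 \pmod{z(13)}$. Then the bi-periodic Perrin quaternion $QR_m(11,13)$ is invertible in the quaternion algebra $Q_{\mathbb{Z}_{13}}$.
   Context: The bi-periodic Perrin sequence $\{R_n(a,b)\}_{n\ge 0}$ is defined by $R_0(a,b)=3$, $R_1(a,b)=0$, $R_2(a,b)=2$ and, for $n\ge 3$, $R_n(a,b)=aR_{n-2}(a,b)+R_{n-3}(a,b)$ if $n$ is even, $R_n(a,b)=bR_{n-2}(a,b)+R_{n-3}(a,b)$ if $n$ is odd. The sequence $R_n(b,a)$ is obtained by interchanging the roles of $a$ and $b$. The bi-periodic Perrin quaternion is $QR_n(a,b)=R_n(a,b)+R_{n+1}(b,a)i+R_{n+2}(a,b)j+R_{n+3}(b,a)k$ if $n$ is even, and $QR_n(a,b)=R_n(b,a)+R_{n+1}(a,b)i+R_{n+2}(b,a)j+R_{n+3}(a,b)k$ if $n$ is odd; here its integer coefficients are reduced modulo $p=13$. $Q_{\mathbb{Z}_p}$ is the quaternion algebra over the field $\mathbb{Z}_p=\mathbb{Z}/p\mathbb{Z}$ with basis $1,i,j,k$ and $i^2=j^2=-1$, $ij=-ji=k$. $\{F_n\}_{n\ge0}$ is the Fibonacci sequence ($F_0=0$, $F_1=1$, $F_n=F_{n-1}+F_{n-2}$), and the entry point $z(p)$ is the smallest positive integer $z$ with $p\mid F_z$. *)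

theory Defs
  imports "HOL-Number_Theory.Number_Theory" "HOL-Library.Numeral_Type"
begin

datatype 'a quaternion =
  Quaternion (qre: 'a) (qi: 'a) (qj: 'a) (qk: 'a)

instantiation quaternion :: (comm_ring_1) ring_1
begin

definition "0 = Quaternion 0 0 0 0"

definition "1 = Quaternion 1 0 0 0"

definition "x + y =
  Quaternion (qre x + qre y) (qi x + qi y) (qj x + qj y) (qk x + qk y)"

definition "- x = Quaternion (- qre x) (- qi x) (- qj x) (- qk x)"

definition "x - y =
  Quaternion (qre x - qre y) (qi x - qi y) (qj x - qj y) (qk x - qk y)"

definition "x * y = Quaternion
  (qre x * qre y - qi x * qi y - qj x * qj y - qk x * qk y)
  (qre x * qi y + qi x * qre y + qj x * qk y - qk x * qj y)
  (qre x * qj y - qi x * qk y + qj x * qre y + qk x * qi y)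
  (qre x * qk y + qi x * qj y - qj x * qi y + qk x * qre y)"

instance
  by standard
    (auto simp: zero_quaternion_def one_quaternion_def plus_quaternion_def
      uminus_quaternion_def minus_quaternion_def times_quaternion_def algebra_simps)

end

definition quat_i :: "'a::comm_ring_1 quaternion" where
  "quat_i = Quaternion 0 1 0 0"

definition quat_j :: "'a::comm_ring_1 quaternion" where
  "quat_j = Quaternion 0 0 1 0"

definition quat_k :: "'a::comm_ring_1 quaternion" where
  "quat_k = Quaternion 0 0 0 1"

lemma quat_basis_mult:
  "(quat_i :: 'a::comm_ring_1 quaternion) * quat_i = - 1"
  "(quat_j :: 'a quaternion) * quat_j = - 1"
  "(quat_i :: 'a quaternion) * quat_j = quat_k"
  "- ((quat_j :: 'a quaternion) * quat_i) = quat_k"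
  by (simp_all add: quat_i_def quat_j_def quat_k_def one_quaternion_def
      uminus_quaternion_def times_quaternion_def)

definition quat_of_scalar :: "'a::comm_ring_1 \<Rightarrow> 'a quaternion" where
  "quat_of_scalar c = Quaternion c 0 0 0"

lemma quat_of_scalar_commutes: "quat_of_scalar c * x = x * quat_of_scalar c"
  by (simp add: quat_of_scalar_def times_quaternion_def mult.commute)

lemma quaternion_basis_expansion:
  "Quaternion r x y z = quat_of_scalar r + quat_of_scalar x * quat_i
    + quat_of_scalar y * quat_j + quat_of_scalar z * quat_k"
  by (simp add: quat_of_scalar_def quat_i_def quat_j_def quat_k_def
      plus_quaternion_def times_quaternion_def)

(* The class-based "x dvd 1" would only express a one-sided inverse here. *)
definition two_sided_invertible :: "'a::monoid_mult \<Rightarrow> bool" where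
  "two_sided_invertible x \<longleftrightarrow> (\<exists>y. x * y = 1 \<and> y * x = 1)"

fun perrin :: "int \<Rightarrow> int \<Rightarrow> nat \<Rightarrow> int" where
  "perrin a b 0 = 3"
| "perrin a b (Suc 0) = 0"
| "perrin a b (Suc (Suc 0)) = 2"
| "perrin a b (Suc (Suc (Suc n))) =
    (if even (Suc (Suc (Suc n))) then a else b) * perrin a b (Suc n) + perrin a b n"

(* Together with the library's commutative ring structure: the type 13 is a field. *)
lemma mod_13_inverse:
  assumes "(x :: 13) \<noteq> 0"
  shows "\<exists>y. x * y = 1"
proof -
  obtain z where z: "x = of_int z" "0 \<le> z" "z < 13"
    by (cases x rule: bit1_cases) auto
  then have "z \<noteq> 0"
    using assms by auto
  then have "\<not> 13 dvd z"
    using z(2,3) by presburger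
  moreover have "prime (13 :: int)"
    by simp
  ultimately have "coprime z 13"
    by (metis coprime_commute prime_imp_coprime)
  then obtain w where "[z * w = 1] (mod 13)"
    using cong_solve_coprime_int by blast
  then obtain k where "z * w = 1 + 13 * k"
    by (metis cong_iff_lin cong_sym)
  then have "(of_int (z * w) :: 13) = of_int 1 + of_int 13 * of_int k"
    by (metis of_int_add of_int_mult)
  moreover have "(of_int 13 :: 13) = 0"
    by simp
  ultimately have "x * of_int w = 1"
    using z(1) by (simp only: of_int_mult of_int_1 mult_zero_left add_0_right)
  then show ?thesis
    by blast
qed

(* The integer coefficients are mapped into the coefficient ring 'a by the canonical
   homomorphism; for 'a = 13, the ring of integers modulo 13, this is reduction modulo 13. *)
definition perrin_quaternion :: "int \<Rightarrow> int \<Rightarrow> nat \<Rightarrow> 'a::comm_ring_1 quaternion" where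
  "perrin_quaternion a b n =
    (if even n
     then Quaternion (of_int (perrin a b n)) (of_int (perrin b a (n + 1)))
            (of_int (perrin a b (n + 2))) (of_int (perrin b a (n + 3)))
     else Quaternion (of_int (perrin b a n)) (of_int (perrin a b (n + 1)))
            (of_int (perrin b a (n + 2))) (of_int (perrin a b (n + 3))))"

definition fib_entry_point :: "nat \<Rightarrow> nat" where
  "fib_entry_point p = (LEAST z. 0 < z \<and> p dvd fib z)"

end

theory Submission
  imports Defs
begin

text \<open>
  Modulo 13 we have $a = 11 = -2$ and $b = 0$, so both subsequences that enter a quaternion of
  odd index have the characteristic polynomial $x^3 + 2x^2 - 1 = (x + 1)(x^2 + x - 1)$ and are,
  up to alternating signs, a constant plus a Fibonacci-type sequence. Writing $m = 2t + 1$, the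
  hypothesis means that 13 divides $F_{t+3}$, which makes all four coefficients affine functions
  of $F_{t+2}$. The norm collapses to $-2 F_{t+2}^2$, which is a unit since $F_{t+2}^2$ is $1$
  or $-1$ by Cassini's identity.
\<close>

text \<open>Multiplying by the conjugate on either side gives the scalar norm, so the conjugate
  scaled by \<open>c\<close> is a two-sided inverse.\<close>

lemma quaternion_invertible_if_norm_unit:
  fixes r x y z c :: "'a::comm_ring_1"
  assumes "(r\<^sup>2 + x\<^sup>2 + y\<^sup>2 + z\<^sup>2) * c = 1"
  shows "two_sided_invertible (Quaternion r x y z)"
proof -
  have "r * (r * c) + x * (x * c) + y * (y * c) + z * (z * c) = 1"
    using assms by (simp add: power2_eq_square algebra_simps)
  then have "Quaternion r x y z * Quaternion (r * c) (- (x * c)) (- (y * c)) (- (z * c)) = 1"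
    and "Quaternion (r * c) (- (x * c)) (- (y * c)) (- (z * c)) * Quaternion r x y z = 1"
    by (simp_all add: times_quaternion_def one_quaternion_def algebra_simps)
  then show ?thesis
    unfolding two_sided_invertible_def by blast
qed

text \<open>The witness \<open>k\<close> ensures that the \<open>LEAST\<close> in the entry point is
  attained; \<open>fib_gcd\<close> then turns divisibility of indices into divisibility of Fibonacci
  numbers.\<close>

lemma dvd_fib_if_entry_point_dvd:
  assumes "0 < k" "p dvd fib k" "fib_entry_point p dvd n"
  shows "p dvd fib n"
proof -
  have "0 < fib_entry_point p \<and> p dvd fib (fib_entry_point p)"
    unfolding fib_entry_point_def by (rule LeastI[of _ k]) (use assms in simp)
  moreover have "fib (fib_entry_point p) dvd fib n"
    using assms(3) by (metis fib_gcd gcd_dvd2 gcd_nat.absorb1)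
  ultimately show ?thesis
    using dvd_trans by blast
qed

lemma perrin_step3:
  "perrin a b (n + 3) = (if even n then b else a) * perrin a b (n + 1) + perrin a b n"
  by (simp add: numeral_3_eq_3)

lemma perrin_initial:
  "perrin a b 0 = 3" "perrin a b 1 = 0" "perrin a b 2 = 2"
  "perrin a b 3 = 3" "perrin a b 4 = 2 * a" "perrin a b 5 = 3 * b + 2"
proof -
  show start: "perrin a b 0 = 3" "perrin a b 1 = 0" "perrin a b 2 = 2"
    by (simp_all add: numeral_2_eq_2)
  show "perrin a b 3 = 3"
    using perrin_step3[of a b 0] start by simp
  then show "perrin a b 4 = 2 * a" "perrin a b 5 = 3 * b + 2"
    using perrin_step3[of a b 1] perrin_step3[of a b 2] start by simp_all
qed

declare perrin.simps [simp del]

text \<open>Two applications of the recurrence. The only term of opposite index parity is the one at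
  \<open>n + 1\<close>; where its coefficient is 13 it vanishes modulo 13, leaving a recurrence
  within one parity class.\<close>

lemma perrin_step6:
  "perrin a b (n + 6) =
    (if even n then a else b) * perrin a b (n + 4)
    + (if even n then b else a) * perrin a b (n + 1) + perrin a b n"
proof -
  have "n + 6 = (n + 3) + 3" "n + 4 = (n + 3) + 1"
    by simp_all
  then show ?thesis
    using perrin_step3[of a b n] perrin_step3[of a b "n + 3"] by (simp only:) simp
qed

lemma fib_3: "fib 3 = 2"
  by (simp add: numeral_3_eq_3)

text \<open>Tailored to $x^3 = -2x^2 + 1$: there is no linear term, so the step uses only
  \<open>P n\<close> and \<open>P (n + 2)\<close>.\<close>

lemma three_step_induct:
  assumes "P 0" "P 1" "P 2"
    and "\<And>n. P n \<Longrightarrow> P (n + 2) \<Longrightarrow> P (n + 3)"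
  shows "P (n :: nat)"
proof -
  have "P n \<and> P (n + 1) \<and> P (n + 2)"
    using assms by (induction n) (auto simp: numeral_eq_Suc)
  then show ?thesis ..
qed

lemma numerals_mod_13: "(11 :: 13) = - 2" "(13 :: 13) = 0"
  by simp_all

text \<open>The constant 5 belongs to the root -1, the Fibonacci terms to $x^2 + x - 1$; the
  coefficients are fitted to the values 3, 2, 22 at indices 0, 2, 4.\<close>

lemma perrin_even_mod_13:
  "(of_int (perrin 11 13 (2 * s)) :: 13) =
    (- 1) ^ s * (5 - 5 * of_nat (fib s) - 2 * of_nat (fib (s + 1)))"
proof (induction s rule: three_step_induct)
  case (4 s)
  have "perrin 11 13 (2 * (s + 3)) =
      11 * perrin 11 13 (2 * (s + 2)) + 13 * perrin 11 13 (2 * s + 1) + perrin 11 13 (2 * s)"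
  proof -
    have "2 * (s + 3) = 2 * s + 6" "2 * (s + 2) = 2 * s + 4"
      by simp_all
    then show ?thesis
      using perrin_step6[of 11 13 "2 * s"] by (simp only:) simp
  qed
  then have "(of_int (perrin 11 13 (2 * (s + 3))) :: 13) =
      - 2 * of_int (perrin 11 13 (2 * (s + 2))) + of_int (perrin 11 13 (2 * s))"
    by (simp only: of_int_add of_int_mult of_int_numeral numerals_mod_13 mult_zero_left add_0_right)
  then show ?case
    unfolding 4 by (simp add: numeral_eq_Suc algebra_simps)
qed (simp_all add: perrin_initial[simplified] fib_3)

text \<open>Same shape, fitted to the values 0, 3, 35 at indices 1, 3, 5.\<close>

lemma perrin_odd_mod_13:
  "(of_int (perrin 13 11 (2 * s + 1)) :: 13) =
    (- 1) ^ s * (1 - 3 * of_nat (fib s) - of_nat (fib (s + 1)))"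
proof (induction s rule: three_step_induct)
  case (4 s)
  have "perrin 13 11 (2 * (s + 3) + 1) =
      11 * perrin 13 11 (2 * (s + 2) + 1) + 13 * perrin 13 11 (2 * s + 2)
      + perrin 13 11 (2 * s + 1)"
  proof -
    have "2 * (s + 3) + 1 = (2 * s + 1) + 6" "2 * (s + 2) + 1 = (2 * s + 1) + 4"
        "2 * s + 2 = (2 * s + 1) + 1"
      by simp_all
    then show ?thesis
      using perrin_step6[of 13 11 "2 * s + 1"] by (simp only:) simp
  qed
  then have "(of_int (perrin 13 11 (2 * (s + 3) + 1)) :: 13) =
      - 2 * of_int (perrin 13 11 (2 * (s + 2) + 1)) + of_int (perrin 13 11 (2 * s + 1))"
    by (simp only: of_int_add of_int_mult of_int_numeral numerals_mod_13 mult_zero_left add_0_right)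
  then show ?case
    unfolding 4 by (simp add: numeral_eq_Suc algebra_simps)
qed (simp_all add: perrin_initial[simplified] fib_3)

theorem corollary3:
  fixes m :: nat
  assumes "odd m"
    and "[(int m - 1) div 2 = - 3] (mod int (fib_entry_point 13))"
  shows "two_sided_invertible (perrin_quaternion 11 13 m :: 13 quaternion)"
proof -
  obtain t where m: "m = 2 * t + 1"
    using assms(1) by (elim oddE)
  define f :: 13 where "f = of_nat (fib (t + 2))"
  define e :: 13 where "e = (- 1) ^ t"
  have e2: "e * e = 1"
    by (simp add: e_def flip: power_add)
  have "int (fib_entry_point 13) dvd int (t + 3)"
    using assms(2) by (simp add: m cong_iff_dvd_diff)
  then have "fib_entry_point 13 dvd t + 3"
    by (simp only: int_dvd_int_iff)
  moreover have "fib 7 = 13"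
    by (simp add: numeral_eq_Suc)
  ultimately have "13 dvd fib (t + 3)"
    using dvd_fib_if_entry_point_dvd[of 7 13 "t + 3"] by simp
  then obtain k where "fib (t + 3) = 13 * k"
    by (elim dvdE)
  then have f3: "(of_nat (fib (t + 3)) :: 13) = 0"
    by (simp add: numerals_mod_13)
  have "fib (t + 3) = fib (t + 2) + fib (t + 1)" and "fib (t + 2) = fib (t + 1) + fib t"
    by (simp_all add: numeral_eq_Suc)
  \<comment> \<open>The Fibonacci recurrence is run backwards from $F_{t+3} = 0$.\<close>
  then have f1: "(of_nat (fib (t + 1)) :: 13) = - f" and f0: "(of_nat (fib t) :: 13) = 2 * f"
    using f3 by (simp_all add: f_def eq_neg_iff_add_eq_0 add.commute)
  have cassini: "int (fib (t + 3)) * int (fib (t + 1)) - int (fib (t + 2)) * int (fib (t + 2))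
      = (- 1) ^ t"
    using fib_Cassini_int[of "t + 1"] by (simp add: numeral_eq_Suc power2_eq_square)
  have "of_nat (fib (t + 3)) * of_nat (fib (t + 1)) - of_nat (fib (t + 2)) * of_nat (fib (t + 2))
      = ((- 1) ^ t :: 13)"
    using arg_cong[OF cassini, of "of_int :: int \<Rightarrow> 13"] by simp
  then have f_square: "f * f = - e"
    using f3 by (simp add: f_def e_def minus_equation_iff)
  \<comment> \<open>These match the four coefficient indices to the closed forms at
    \<open>t\<close>, \<open>t + 1\<close>, \<open>t + 1\<close> and \<open>t + 2\<close>.\<close>
  have indices: "2 * t + 1 = m" "2 * (t + 1) = m + 1" "2 * (t + 1) + 1 = m + 2" "2 * (t + 2) = m + 3"
      "t + 1 + 1 = t + 2" "t + 2 + 1 = t + 3"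
    by (simp_all add: m)
  note coefficient_simps = indices f0 f1 f_def[symmetric] f3
  have r: "of_int (perrin 13 11 m) = e * (1 - 5 * f)"
    using perrin_odd_mod_13[of t] unfolding coefficient_simps by (simp add: e_def)
  have x: "of_int (perrin 11 13 (m + 1)) = - e * (3 * f + 5)"
    using perrin_even_mod_13[of "t + 1"] unfolding coefficient_simps by (simp add: e_def)
  have y: "of_int (perrin 13 11 (m + 2)) = - e * (2 * f + 1)"
    using perrin_odd_mod_13[of "t + 1"] unfolding coefficient_simps by (simp add: e_def)
  have z: "of_int (perrin 11 13 (m + 3)) = e * (5 - 5 * f)"
    using perrin_even_mod_13[of "t + 2"] unfolding coefficient_simps by (simp add: e_def)
  \<comment> \<open>The norm is \<open>2 * e\<close>, whose inverse is \<open>7 * e\<close> because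
    14 = 1 modulo 13 and \<open>e * e = 1\<close>.\<close>
  have "((e * (1 - 5 * f))\<^sup>2 + (- e * (3 * f + 5))\<^sup>2 + (- e * (2 * f + 1))\<^sup>2
      + (e * (5 - 5 * f))\<^sup>2) * (7 * e) = 1" (is "?N * (7 * e) = 1")
  proof -
    \<comment> \<open>The squares add up to $52 - 26f + 63f^2$; splitting 63 as 65 - 2 isolates the
      multiple of 13.\<close>
    have "?N = (e * e) * (13 * (4 - 2 * f + 5 * (f * f)) - 2 * (f * f))"
      by (simp add: power2_eq_square algebra_simps)
    also have "\<dots> = 2 * e"
      by (simp add: e2 f_square numerals_mod_13)
    finally show ?thesis
      by (simp add: e2 mult.assoc)
  qed
  then have "two_sided_invertible
      (Quaternion (e * (1 - 5 * f)) (- e * (3 * f + 5)) (- e * (2 * f + 1)) (e * (5 - 5 * f)))"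
    by (rule quaternion_invertible_if_norm_unit)
  then show ?thesis
    unfolding perrin_quaternion_def r x y z using assms(1) by (simp only: if_False)
qed

end
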